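(* Let $s'=(u_1',u_2',u_3')$ be a candidate next state whose coordinate determinant is nonzero and for which $\langle n_1,n_1\rangle\ne0$. Then $$\operatorname{score}(s')=-\frac{|\det(\xi,\nu,\bar\nu)|^2\,|\xi|^2}{|\langle n_1,n_1\rangle|^2}.$$ In particular the score is real and strictly negative.
   Context: Let $p\in\mathbb Z[x]$ be a monic irreducible cubic of signature $(1,1)$ (one real root, one pair of non-real complex conjugate roots), $\alpha$ its real root, $K=\mathbb Q(\alpha)$, $L=\mathbb Z[\alpha]$ with basis $(1,\alpha,\alpha^2)$, $\sigma_r:K\to\mathbb R$ the real embedding, and $\sigma_c:K\to\mathbb C$ one complex embedding. A state is an ordered triple of elements of $L$; its coordinate determinant is the determinant of the $3\times 3$ matrix of its coordinates in the basis $(1,\alpha,\alpha^2)$. It is admissible if its three real embeddings are positive. A candidate next state is the image of an admissible state, relabeled so that $x=\sigma_r(u_1)>y=\sigma_r(u_2)>z=\sigma_r(u_3)>0$ and written as a column vector, under one of the admissible unimodular moves $$V(a,b,g)=\begin{pmatrix}1&-g&gb-a\\0&1&-b\\0&0&1\end{pmatrix},\qquad W=\begin{pmatrix}1&-1&0\\0&1&0\\-1&1&1\end{pmatrix},$$ where $V(a,b,g)$ is admissible for integers $0\le a\le\lfloor x/z\rfloor$, $0\le b\le\lfloor y/z\rfloor$, $0\le g\le\lfloor (x/z-a)/(y/z-b)\rfloor$, $(a,b,g)\ne(0,0,0)$, and $W$ is admissible when $z>x-y>0$. For $s'=(u_1',u_2',u_3')$ put $\xi=(\sigma_r(u_1'),\sigma_r(u_2'),\sigma_r(u_3'))\in\mathbb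 R^3$ and $\nu=(\sigma_c(u_1'),\sigma_c(u_2'),\sigma_c(u_3'))\in\mathbb C^3$. Let $\times$ and $\langle\cdot,\cdot\rangle$ be the formal bilinear (non-Hermitian) cross and dot products on $\mathbb C^3$, let $|\xi|$ be the Euclidean norm, and set $n_1=\xi\times\nu$, $n_2=\xi\times\bar\nu$, $$\operatorname{score}(s')=\operatorname{Re}\left[\frac{\langle n_1\times n_2,n_1\times n_2\rangle}{\langle n_1,n_1\rangle\langle n_2,n_2\rangle}\right].$$ *)

theory Defs
  imports "HOL-Analysis.Analysis" "HOL-Computational_Algebra.Computational_Algebra"
begin

section \<open>The cubic field and its embeddings\<close>

text \<open>The number of distinct roots is counted; for an irreducible polynomial over the integers
  this agrees with counting with multiplicity, since its complex roots are simple.\<close>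

definition has_signature :: "int poly \<Rightarrow> nat \<Rightarrow> nat \<Rightarrow> bool" where
  "has_signature p r c \<longleftrightarrow>
     card {x::real. poly (map_poly of_int p) x = 0} = r \<and>
     card {w::complex. poly (map_poly of_int p) w = 0 \<and> w \<notin> \<real>} = 2 * c"

definition is_subring :: "'a::comm_ring_1 set \<Rightarrow> bool" where
  "is_subring R \<longleftrightarrow> 1 \<in> R \<and> (\<forall>u\<in>R. \<forall>v\<in>R. u - v \<in> R \<and> u * v \<in> R)"

definition is_subfield :: "'a::field set \<Rightarrow> bool" where
  "is_subfield F \<longleftrightarrow> is_subring F \<and> (\<forall>u\<in>F. inverse u \<in> F)"

text \<open>Both \<open>K = \<rat>(\<alpha>)\<close> and \<open>L = \<int>[\<alpha>]\<close> are taken inside the reals, as the least subfield and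
  the least subring containing \<open>\<alpha>\<close> (every subfield of the reals contains the rationals).\<close>

definition field_K :: "real \<Rightarrow> real set" where
  "field_K \<alpha> = is_subfield hull {\<alpha>}"

definition lattice_L :: "real \<Rightarrow> real set" where
  "lattice_L \<alpha> = is_subring hull {\<alpha>}"

text \<open>Values of \<open>\<sigma>\<close> outside \<open>K\<close> are irrelevant.\<close>

definition field_embedding :: "'a::field set \<Rightarrow> ('a \<Rightarrow> 'b::field) \<Rightarrow> bool" where
  "field_embedding K \<sigma> \<longleftrightarrow>
     \<sigma> 1 = 1 \<and> (\<forall>u\<in>K. \<forall>v\<in>K. \<sigma> (u + v) = \<sigma> u + \<sigma> v \<and> \<sigma> (u * v) = \<sigma> u * \<sigma> v)"

text \<open>A complex embedding in the sense of the signature, i.e. one that is not real.\<close>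

definition complex_embedding :: "real set \<Rightarrow> (real \<Rightarrow> complex) \<Rightarrow> bool" where
  "complex_embedding K \<sigma> \<longleftrightarrow> field_embedding K \<sigma> \<and> \<not> \<sigma> ` K \<subseteq> \<real>"

section \<open>States and moves\<close>

definition is_state :: "real \<Rightarrow> real^3 \<Rightarrow> bool" where
  "is_state \<alpha> s \<longleftrightarrow> (\<forall>i. s $ i \<in> lattice_L \<alpha>)"

text \<open>Well defined for \<open>u \<in> L\<close> when \<open>\<alpha>\<close> is a root of a monic irreducible integer cubic, because
  then \<open>(1, \<alpha>, \<alpha>\<^sup>2)\<close> is a basis of \<open>L\<close>.\<close>

definition coords :: "real \<Rightarrow> real \<Rightarrow> int^3" where
  "coords \<alpha> u = (THE c. u = of_int (c $ 1) + of_int (c $ 2) * \<alpha> + of_int (c $ 3) * \<alpha>\<^sup>2)"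

definition coord_det :: "real \<Rightarrow> real^3 \<Rightarrow> int" where
  "coord_det \<alpha> s = det (\<chi> i. coords \<alpha> (s $ i))"

definition admissible_state :: "real \<Rightarrow> (real \<Rightarrow> real) \<Rightarrow> real^3 \<Rightarrow> bool" where
  "admissible_state \<alpha> \<sigma>r s \<longleftrightarrow> is_state \<alpha> s \<and> (\<forall>i. \<sigma>r (s $ i) > 0)"

definition move_V :: "int \<Rightarrow> int \<Rightarrow> int \<Rightarrow> int^3^3" where
  "move_V a b g = vector [vector [1, -g, g * b - a],
                          vector [0,  1, -b],
                          vector [0,  0,  1]]"

definition move_W :: "int^3^3" where
  "move_W = vector [vector [ 1, -1, 0],
                    vector [ 0,  1, 0],
                    vector [-1,  1, 1]]"

text \<open>If \<open>y / z = b\<close>, the bound on \<open>g\<close> divides by zero, and the convention \<open>t / 0 = 0\<close> leaves only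
  \<open>g = 0\<close>. This does not affect states with nonzero coordinate determinant: there
  \<open>u\<^sub>2 = b u\<^sub>3\<close> would hold in \<open>K\<close>, and the moves are unimodular.\<close>

definition admissible_move :: "real \<Rightarrow> real \<Rightarrow> real \<Rightarrow> int^3^3 \<Rightarrow> bool" where
  "admissible_move x y z M \<longleftrightarrow>
     (\<exists>a b g. 0 \<le> a \<and> a \<le> \<lfloor>x / z\<rfloor> \<and>
              0 \<le> b \<and> b \<le> \<lfloor>y / z\<rfloor> \<and>
              0 \<le> g \<and> g \<le> \<lfloor>(x / z - of_int a) / (y / z - of_int b)\<rfloor> \<and>
              (a, b, g) \<noteq> (0, 0, 0) \<and> M = move_V a b g) \<or>
     (z > x - y \<and> x - y > 0 \<and> M = move_W)"

definition candidate_next_state :: "real \<Rightarrow> (real \<Rightarrow> real) \<Rightarrow> real^3 \<Rightarrow> bool" where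
  "candidate_next_state \<alpha> \<sigma>r s' \<longleftrightarrow>
     (\<exists>s \<pi> u M. admissible_state \<alpha> \<sigma>r s \<and> bij \<pi> \<and> u = (\<chi> i. s $ \<pi> i) \<and>
        \<sigma>r (u $ 1) > \<sigma>r (u $ 2) \<and> \<sigma>r (u $ 2) > \<sigma>r (u $ 3) \<and> \<sigma>r (u $ 3) > 0 \<and>
        admissible_move (\<sigma>r (u $ 1)) (\<sigma>r (u $ 2)) (\<sigma>r (u $ 3)) M \<and>
        s' = map_matrix of_int M *v u)"

section \<open>The score\<close>

definition bilin_cross :: "complex^3 \<Rightarrow> complex^3 \<Rightarrow> complex^3" where
  "bilin_cross v w = vector [v $ 2 * w $ 3 - v $ 3 * w $ 2,
                             v $ 3 * w $ 1 - v $ 1 * w $ 3,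
                             v $ 1 * w $ 2 - v $ 2 * w $ 1]"

text \<open>Bilinear, unlike the inner product \<open>\<bullet>\<close> on \<open>complex^3\<close>.\<close>

definition bilin_dot :: "complex^3 \<Rightarrow> complex^3 \<Rightarrow> complex" where
  "bilin_dot v w = (\<Sum>i\<in>UNIV. v $ i * w $ i)"

definition cvec :: "real^3 \<Rightarrow> complex^3" where
  "cvec v = (\<chi> i. complex_of_real (v $ i))"

definition cnj_vec :: "complex^3 \<Rightarrow> complex^3" where
  "cnj_vec v = (\<chi> i. cnj (v $ i))"

definition det3 :: "complex^3 \<Rightarrow> complex^3 \<Rightarrow> complex^3 \<Rightarrow> complex" where
  "det3 u v w = det (transpose (vector [u, v, w]))"

definition xi_vec :: "(real \<Rightarrow> real) \<Rightarrow> real^3 \<Rightarrow> real^3" where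
  "xi_vec \<sigma>r s = (\<chi> i. \<sigma>r (s $ i))"

definition nu_vec :: "(real \<Rightarrow> complex) \<Rightarrow> real^3 \<Rightarrow> complex^3" where
  "nu_vec \<sigma>c s = (\<chi> i. \<sigma>c (s $ i))"

definition n1 :: "(real \<Rightarrow> real) \<Rightarrow> (real \<Rightarrow> complex) \<Rightarrow> real^3 \<Rightarrow> complex^3" where
  "n1 \<sigma>r \<sigma>c s = bilin_cross (cvec (xi_vec \<sigma>r s)) (nu_vec \<sigma>c s)"

definition n2 :: "(real \<Rightarrow> real) \<Rightarrow> (real \<Rightarrow> complex) \<Rightarrow> real^3 \<Rightarrow> complex^3" where
  "n2 \<sigma>r \<sigma>c s = bilin_cross (cvec (xi_vec \<sigma>r s)) (cnj_vec (nu_vec \<sigma>c s))"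

text \<open>The complex number whose real part is the score.\<close>

definition score_ratio :: "(real \<Rightarrow> real) \<Rightarrow> (real \<Rightarrow> complex) \<Rightarrow> real^3 \<Rightarrow> complex" where
  "score_ratio \<sigma>r \<sigma>c s =
     (let m1 = n1 \<sigma>r \<sigma>c s; m2 = n2 \<sigma>r \<sigma>c s; m = bilin_cross m1 m2
      in bilin_dot m m / (bilin_dot m1 m1 * bilin_dot m2 m2))"

definition score :: "(real \<Rightarrow> real) \<Rightarrow> (real \<Rightarrow> complex) \<Rightarrow> real^3 \<Rightarrow> real" where
  "score \<sigma>r \<sigma>c s = Re (score_ratio \<sigma>r \<sigma>c s)"

end

theory Submission
  imports Defs
begin

text \<open>The cross product satisfies \<open>(a \<times> b) \<times> (a \<times> c) = det(a, b, c) a\<close>, so the numerator of the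
  score is \<open>det(\<xi>, \<nu>, \<nu>')\<^sup>2 |\<xi>|\<^sup>2\<close> with \<open>\<nu>'\<close> the conjugate of \<open>\<nu>\<close>. Conjugation swaps the last two
  columns, so this determinant is purely imaginary and its square is \<open>- |det|\<^sup>2\<close>. As \<open>n\<^sub>2\<close> is the
  conjugate of \<open>n\<^sub>1\<close>, the denominator is \<open>|\<langle>n\<^sub>1, n\<^sub>1\<rangle>|\<^sup>2\<close>. For strict negativity, write \<open>w\<close> for the
  image of \<open>\<alpha>\<close> under the complex embedding: the determinant is the coordinate determinant times
  the Vandermonde determinant of \<open>\<sigma>\<^sub>r(\<alpha>)\<close>, \<open>w\<close> and the conjugate of \<open>w\<close>, which are distinct because
  \<open>w\<close> is not real.\<close>

\<comment> \<open>Power series coefficients use the same symbol as vector components.\<close>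
no_notation fps_nth (infixl \<open>$\<close> 75)

section \<open>The score of a real and a complex vector\<close>

lemma det3_expand:
  "det3 u v w = u $ 1 * (v $ 2 * w $ 3 - v $ 3 * w $ 2) - u $ 2 * (v $ 1 * w $ 3 - v $ 3 * w $ 1)
     + u $ 3 * (v $ 1 * w $ 2 - v $ 2 * w $ 1)"
  by (simp add: det3_def det_3 transpose_def algebra_simps)

lemma bilin_cross_cross:
  "bilin_cross (bilin_cross a b) (bilin_cross a c) = det3 a b c *s a"
  by (simp add: vec_eq_iff forall_3 bilin_cross_def det3_expand algebra_simps)

lemma bilin_dot_scale: "bilin_dot (c *s v) (c *s v) = c\<^sup>2 * bilin_dot v v"
  by (simp add: bilin_dot_def sum_distrib_left power2_eq_square mult_ac)

lemma bilin_dot_cvec: "bilin_dot (cvec v) (cvec v) = of_real ((norm v)\<^sup>2)"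
  unfolding power2_norm_eq_inner by (simp add: bilin_dot_def cvec_def inner_vec_def)

lemma bilin_cross_cvec_cnj: "bilin_cross (cvec v) (cnj_vec w) = cnj_vec (bilin_cross (cvec v) w)"
  by (simp add: vec_eq_iff forall_3 bilin_cross_def cvec_def cnj_vec_def)

lemma bilin_dot_cnj: "bilin_dot (cnj_vec v) (cnj_vec v) = cnj (bilin_dot v v)"
  by (simp add: bilin_dot_def cnj_vec_def)

lemma det3_cnj_square:
  "(det3 (cvec v) w (cnj_vec w))\<^sup>2 = - of_real ((cmod (det3 (cvec v) w (cnj_vec w)))\<^sup>2)"
proof -
  let ?d = "det3 (cvec v) w (cnj_vec w)"
  have "cnj ?d = - ?d"
    by (simp add: det3_expand cvec_def cnj_vec_def algebra_simps)
  then show ?thesis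
    unfolding complex_norm_square by (simp add: power2_eq_square)
qed

text \<open>Stated for the complex ratio, so that both the formula for its real part and the
  realness of the ratio follow. If the denominator vanishes, both sides are 0 by the convention
  \<open>x / 0 = 0\<close>.\<close>

lemma score_ratio_eq:
  "score_ratio \<sigma>r \<sigma>c s = of_real
     (- ((cmod (det3 (cvec (xi_vec \<sigma>r s)) (nu_vec \<sigma>c s) (cnj_vec (nu_vec \<sigma>c s))))\<^sup>2
          * (norm (xi_vec \<sigma>r s))\<^sup>2)
       / (cmod (bilin_dot (n1 \<sigma>r \<sigma>c s) (n1 \<sigma>r \<sigma>c s)))\<^sup>2)"
proof -
  have n2: "n2 \<sigma>r \<sigma>c s = cnj_vec (n1 \<sigma>r \<sigma>c s)"
    by (simp add: n1_def n2_def bilin_cross_cvec_cnj)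
  have cross: "bilin_cross (n1 \<sigma>r \<sigma>c s) (n2 \<sigma>r \<sigma>c s)
      = det3 (cvec (xi_vec \<sigma>r s)) (nu_vec \<sigma>c s) (cnj_vec (nu_vec \<sigma>c s)) *s cvec (xi_vec \<sigma>r s)"
    by (simp add: n1_def n2_def bilin_cross_cross)
  have den: "bilin_dot (n1 \<sigma>r \<sigma>c s) (n1 \<sigma>r \<sigma>c s) * bilin_dot (n2 \<sigma>r \<sigma>c s) (n2 \<sigma>r \<sigma>c s)
      = of_real ((cmod (bilin_dot (n1 \<sigma>r \<sigma>c s) (n1 \<sigma>r \<sigma>c s)))\<^sup>2)"
    unfolding complex_norm_square by (simp add: n2 bilin_dot_cnj)
  show ?thesis
    unfolding score_ratio_def Let_def den cross bilin_dot_scale bilin_dot_cvec det3_cnj_square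
    by simp
qed

section \<open>Integer quadratic expressions\<close>

text \<open>Polymorphic in the argument, so that one coordinate vector can be evaluated at \<alpha>
  and at its images under the embeddings.\<close>

definition int_quad :: "int^3 \<Rightarrow> 'a::comm_ring_1 \<Rightarrow> 'a" where
  "int_quad c t = of_int (c $ 1) + of_int (c $ 2) * t + of_int (c $ 3) * t\<^sup>2"

lemma int_quad_diff: "int_quad (c - d) t = int_quad c t - int_quad d t"
  by (simp add: int_quad_def algebra_simps)

lemma cnj_int_quad: "cnj (int_quad c t) = int_quad c (cnj t)"
  by (simp add: int_quad_def)

lemma int_quad_eq_0:
  fixes x y z :: "'a::field_char_0"
  assumes "x \<noteq> y" "x \<noteq> z" "y \<noteq> z"
    and "int_quad c x = 0" "int_quad c y = 0" "int_quad c z = 0"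
  shows "c = 0"
proof -
  let ?b = "of_int (c $ 2) :: 'a" and ?c = "of_int (c $ 3) :: 'a"
  \<comment> \<open>Divided differences: a root pair with distinct entries leaves a linear condition
    on the two higher coefficients. Subtracting two such conditions isolates the leading
    one.\<close>
  have "(x - y) * (?b + ?c * (x + y)) = int_quad c x - int_quad c y"
    and "(x - z) * (?b + ?c * (x + z)) = int_quad c x - int_quad c z"
    by (simp_all add: int_quad_def algebra_simps power2_eq_square)
  with assms have y: "?b + ?c * (x + y) = 0" and z: "?b + ?c * (x + z) = 0"
    by auto
  have "?c * (y - z) = (?b + ?c * (x + y)) - (?b + ?c * (x + z))"
    by (simp add: algebra_simps)
  with y z assms(3) have c: "c $ 3 = 0"
    by simp
  with y have b: "c $ 2 = 0"
    by simp
  from assms(4) b c have "c $ 1 = 0"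
    by (simp add: int_quad_def)
  with b c show ?thesis
    by (simp add: vec_eq_iff forall_3)
qed

lemma det_of_int: "det (map_matrix of_int C :: 'a::comm_ring_1^3^3) = of_int (det C)"
  by (simp add: det_3 map_matrix_def)

text \<open>Each entry is a row of \<open>C\<close> times a column (1, t, t^2), so the matrix
  factors as \<open>C\<close> times a Vandermonde matrix.\<close>

lemma det3_int_quad:
  "det3 (\<chi> i. int_quad (C $ i) x) (\<chi> i. int_quad (C $ i) y) (\<chi> i. int_quad (C $ i) z)
     = of_int (det C) * ((y - x) * (z - x) * (z - y))"
proof -
  let ?P = "vector [vector [1, 1, 1], vector [x, y, z], vector [x\<^sup>2, y\<^sup>2, z\<^sup>2]] :: complex^3^3"
  have "transpose (vector [\<chi> i. int_quad (C $ i) x, \<chi> i. int_quad (C $ i) y,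
          \<chi> i. int_quad (C $ i) z]) = map_matrix of_int C ** ?P"
    by (simp add: vec_eq_iff forall_3 transpose_def matrix_matrix_mult_def sum_3 int_quad_def
        map_matrix_def)
  moreover have "det ?P = (y - x) * (z - x) * (z - y)"
    by (simp add: det_3 algebra_simps power2_eq_square)
  ultimately show ?thesis
    by (simp add: det3_def det_mul det_of_int)
qed

lemma monic_cubic_root:
  fixes \<alpha> :: real
  assumes "lead_coeff p = 1" "degree p = 3" "poly (map_poly of_int p) \<alpha> = 0"
  shows "\<alpha> ^ 3 = - int_quad (vector [coeff p 0, coeff p 1, coeff p 2]) \<alpha>"
proof -
  have "degree (map_poly of_int p :: real poly) = 3"
    using assms(2) by (simp add: degree_map_poly)
  then have "poly (map_poly of_int p) \<alpha> = (\<Sum>i\<le>3. of_int (coeff p i) * \<alpha> ^ i)"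
    by (simp add: poly_altdef coeff_map_poly)
  then show ?thesis
    using assms by (simp add: int_quad_def eval_nat_numeral)
qed

text \<open>The cubic relation lowers the powers \<alpha>^3 and \<alpha>^4 that arise in a product.
  By minimality, this range then contains \<open>lattice_L \<alpha>\<close>.\<close>

lemma is_subring_int_quad:
  fixes \<alpha> :: real
  assumes "\<alpha> ^ 3 = int_quad e \<alpha>"
  shows "is_subring (range (\<lambda>c. int_quad c \<alpha>))"
  unfolding is_subring_def
proof (intro conjI ballI)
  have "1 = int_quad (vector [1, 0, 0]) \<alpha>"
    by (simp add: int_quad_def)
  then show "1 \<in> range (\<lambda>c. int_quad c \<alpha>)" by blast
next
  fix u v assume "u \<in> range (\<lambda>c. int_quad c \<alpha>)" "v \<in> range (\<lambda>c. int_quad c \<alpha>)"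
  then obtain c d where u: "u = int_quad c \<alpha>" and v: "v = int_quad d \<alpha>" by blast
  then have "u - v = int_quad (c - d) \<alpha>"
    by (simp add: int_quad_diff)
  then show "u - v \<in> range (\<lambda>c. int_quad c \<alpha>)" by blast
  \<comment> \<open>\<open>?h\<close> and \<open>?k\<close> are the coefficients of \<alpha>^3 and
    \<alpha>^4 in the product. Multiplying the relation \<open>e\<close> by \<alpha> reduces
    \<alpha>^4, and applying it once more removes the new \<alpha>^3; \<open>f\<close> collects the
    result.\<close>
  let ?h = "c $ 2 * d $ 3 + c $ 3 * d $ 2" and ?k = "c $ 3 * d $ 3"
  define f :: "int^3" where "f = vector
    [c $ 1 * d $ 1 + ?h * e $ 1 + ?k * e $ 3 * e $ 1,
     c $ 1 * d $ 2 + c $ 2 * d $ 1 + ?h * e $ 2 + ?k * (e $ 1 + e $ 3 * e $ 2),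
     c $ 1 * d $ 3 + c $ 2 * d $ 2 + c $ 3 * d $ 1 + ?h * e $ 3 + ?k * (e $ 2 + e $ 3 * e $ 3)]"
  have "int_quad c \<alpha> * int_quad d \<alpha> = of_int (c $ 1 * d $ 1)
      + of_int (c $ 1 * d $ 2 + c $ 2 * d $ 1) * \<alpha>
      + of_int (c $ 1 * d $ 3 + c $ 2 * d $ 2 + c $ 3 * d $ 1) * \<alpha>\<^sup>2
      + of_int ?h * \<alpha> ^ 3 + of_int ?k * (\<alpha> * \<alpha> ^ 3)"
    by (simp add: int_quad_def algebra_simps power2_eq_square power3_eq_cube)
  also have "\<alpha> * \<alpha> ^ 3 = of_int (e $ 1) * \<alpha> + of_int (e $ 2) * \<alpha>\<^sup>2 + of_int (e $ 3) * \<alpha> ^ 3"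
    by (subst assms) (simp add: int_quad_def algebra_simps power2_eq_square power3_eq_cube)
  also have "\<alpha> ^ 3 = int_quad e \<alpha>"
    by (rule assms)
  finally have "u * v = int_quad f \<alpha>"
    unfolding u v f_def by (simp add: int_quad_def algebra_simps)
  then show "u * v \<in> range (\<lambda>c. int_quad c \<alpha>)" by blast
qed

section \<open>Embeddings of the cubic field\<close>

lemma is_subring_add:
  assumes "is_subring R" "u \<in> R" "v \<in> R"
  shows "u + v \<in> R"
proof -
  have sub: "\<And>a b. a \<in> R \<Longrightarrow> b \<in> R \<Longrightarrow> a - b \<in> R"
    using assms(1) by (simp add: is_subring_def)
  \<comment> \<open>\<open>is_subring\<close> offers only differences, so -v is built as (v - v) -
    v.\<close>
  have "u - ((v - v) - v) \<in> R"
    by (intro sub assms)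
  then show ?thesis by simp
qed

lemma is_subring_of_int:
  assumes "is_subring R"
  shows "of_int k \<in> R"
proof -
  have 1: "1 \<in> R" and sub: "\<And>a b. a \<in> R \<Longrightarrow> b \<in> R \<Longrightarrow> a - b \<in> R"
    using assms by (simp_all add: is_subring_def)
  have 0: "0 \<in> R"
    using sub[OF 1 1] by simp
  show ?thesis
  proof (induction k rule: int_induct[where k = 0])
    case base
    then show ?case using 0 by simp
  next
    case (step1 i)
    then show ?case using is_subring_add[OF assms _ 1] by simp
  next
    case (step2 i)
    then show ?case using sub[OF _ 1] by simp
  qed
qed

lemma is_subfield_field_K: "is_subfield (field_K \<alpha>)"
  unfolding field_K_def by (rule hull_in) (auto simp: is_subfield_def is_subring_def)

lemma is_subring_field_K: "is_subring (field_K \<alpha>)"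
  using is_subfield_field_K by (simp add: is_subfield_def)

lemma generator_in_field_K: "\<alpha> \<in> field_K \<alpha>"
  unfolding field_K_def using hull_subset[of "{\<alpha>}" is_subfield] by blast

context
  fixes K :: "'a::field set" and \<sigma> :: "'a \<Rightarrow> 'b::field"
  assumes K: "is_subfield K" and \<sigma>: "field_embedding K \<sigma>"
begin

lemma field_embedding_diff:
  assumes "u \<in> K" "v \<in> K"
  shows "\<sigma> (u - v) = \<sigma> u - \<sigma> v"
proof -
  have "u - v \<in> K"
    using K assms by (simp add: is_subfield_def is_subring_def)
  then have "\<sigma> ((u - v) + v) = \<sigma> (u - v) + \<sigma> v"
    using \<sigma> assms(2) unfolding field_embedding_def by blast
  then show ?thesis by simp
qed

lemma field_embedding_0: "\<sigma> 0 = 0"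
  using field_embedding_diff[of 1 1] K by (simp add: is_subfield_def is_subring_def)

lemma field_embedding_inverse:
  assumes "u \<in> K"
  shows "\<sigma> (inverse u) = inverse (\<sigma> u)"
proof (cases "u = 0")
  case False
  have "inverse u \<in> K"
    using K assms by (simp add: is_subfield_def)
  then have "\<sigma> (u * inverse u) = \<sigma> u * \<sigma> (inverse u)"
    using \<sigma> assms unfolding field_embedding_def by blast
  then have "\<sigma> u * \<sigma> (inverse u) = 1"
    using \<sigma> False by (simp add: field_embedding_def)
  then show ?thesis
    by (metis inverse_unique)
qed (simp add: field_embedding_0)

lemma field_embedding_of_int: "\<sigma> (of_int k) = of_int k"
proof -
  have R: "is_subring K" and 1: "1 \<in> K"
    using K by (simp_all add: is_subfield_def is_subring_def)
  have s1: "\<sigma> 1 = 1" and add: "\<And>u v. u \<in> K \<Longrightarrow> v \<in> K \<Longrightarrow> \<sigma> (u + v) = \<sigma> u + \<sigma> v"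
    using \<sigma> by (simp_all add: field_embedding_def)
  show ?thesis
  proof (induction k rule: int_induct[where k = 0])
    case base
    then show ?case by (simp add: field_embedding_0)
  next
    case (step1 i)
    then show ?case using add[OF is_subring_of_int[OF R] 1] s1 by simp
  next
    case (step2 i)
    then show ?case using field_embedding_diff[OF is_subring_of_int[OF R] 1] s1 by simp
  qed
qed

lemma field_embedding_int_quad:
  assumes "t \<in> K"
  shows "\<sigma> (int_quad c t) = int_quad c (\<sigma> t)"
proof -
  have R: "is_subring K"
    using K by (simp add: is_subfield_def)
  have mem: "u \<in> K \<Longrightarrow> v \<in> K \<Longrightarrow> u * v \<in> K" for u v
    using R by (simp add: is_subring_def)
  have hom: "u \<in> K \<Longrightarrow> v \<in> K \<Longrightarrow> \<sigma> (u + v) = \<sigma> u + \<sigma> v"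
      "u \<in> K \<Longrightarrow> v \<in> K \<Longrightarrow> \<sigma> (u * v) = \<sigma> u * \<sigma> v" for u v
    using \<sigma> by (simp_all add: field_embedding_def)
  show ?thesis
    by (simp add: int_quad_def power2_eq_square hom mem is_subring_add[OF R]
        is_subring_of_int[OF R] field_embedding_of_int assms)
qed

end

text \<open>The elements of \<open>field_K \<alpha>\<close> with real image form a subfield. If it
  contained \<alpha>, minimality would make it all of \<open>field_K \<alpha>\<close>, and the
  embedding would be real.\<close>

lemma complex_embedding_generator_nonreal:
  assumes "complex_embedding (field_K \<alpha>) \<sigma>"
  shows "\<sigma> \<alpha> \<notin> \<real>"
proof
  assume real: "\<sigma> \<alpha> \<in> \<real>"
  let ?K = "field_K \<alpha>" and ?F = "{u \<in> field_K \<alpha>. \<sigma> u \<in> \<real>}"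
  have \<sigma>: "field_embedding ?K \<sigma>" and nonreal: "\<not> \<sigma> ` ?K \<subseteq> \<real>"
    using assms by (simp_all add: complex_embedding_def)
  have K: "1 \<in> ?K" "\<And>u v. u \<in> ?K \<Longrightarrow> v \<in> ?K \<Longrightarrow> u - v \<in> ?K \<and> u * v \<in> ?K"
      "\<And>u. u \<in> ?K \<Longrightarrow> inverse u \<in> ?K"
    using is_subfield_field_K[of \<alpha>] by (simp_all add: is_subfield_def is_subring_def)
  have hom: "\<sigma> 1 = 1" "\<And>u v. u \<in> ?K \<Longrightarrow> v \<in> ?K \<Longrightarrow> \<sigma> (u * v) = \<sigma> u * \<sigma> v"
    using \<sigma> by (simp_all add: field_embedding_def)
  have "is_subfield ?F"
    unfolding is_subfield_def is_subring_def
    by (auto simp: K hom field_embedding_diff[OF is_subfield_field_K \<sigma>]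
        field_embedding_inverse[OF is_subfield_field_K \<sigma>])
  moreover have "{\<alpha>} \<subseteq> ?F"
    using real generator_in_field_K by simp
  ultimately have "?K \<subseteq> ?F"
    by (subst field_K_def) (rule hull_minimal)
  with nonreal show False by blast
qed

text \<open>Two coordinate vectors of one element differ by a polynomial of degree at most 2 with the
  three distinct roots \<open>\<alpha>\<close>, \<open>\<sigma> \<alpha>\<close> and the conjugate of \<open>\<sigma> \<alpha>\<close>.\<close>

lemma coords_int_quad:
  assumes "complex_embedding (field_K \<alpha>) \<sigma>"
  shows "coords \<alpha> (int_quad c \<alpha>) = c"
  unfolding coords_def
proof (rule the_equality)
  show "int_quad c \<alpha> = of_int (c $ 1) + of_int (c $ 2) * \<alpha> + of_int (c $ 3) * \<alpha>\<^sup>2"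
    by (simp add: int_quad_def)
next
  fix d :: "int^3"
  assume "int_quad c \<alpha> = of_int (d $ 1) + of_int (d $ 2) * \<alpha> + of_int (d $ 3) * \<alpha>\<^sup>2"
  then have 0: "int_quad (d - c) \<alpha> = 0"
    by (simp add: int_quad_diff) (simp add: int_quad_def)
  have \<sigma>: "field_embedding (field_K \<alpha>) \<sigma>"
    using assms by (simp add: complex_embedding_def)
  have w: "int_quad (d - c) (\<sigma> \<alpha>) = 0"
    using field_embedding_int_quad[OF is_subfield_field_K \<sigma> generator_in_field_K]
      field_embedding_0[OF is_subfield_field_K \<sigma>] 0 by metis
  have wc: "int_quad (d - c) (cnj (\<sigma> \<alpha>)) = 0"
    using w by (metis cnj_int_quad complex_cnj_zero)
  \<comment> \<open>All three roots have to lie in one field, so \<alpha> is moved into the complex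
    numbers.\<close>
  have "int_quad (d - c) (complex_of_real \<alpha>) = of_real (int_quad (d - c) \<alpha>)"
    by (simp add: int_quad_def)
  then have r: "int_quad (d - c) (complex_of_real \<alpha>) = 0"
    using 0 by simp
  have "\<sigma> \<alpha> \<notin> \<real>"
    using assms by (rule complex_embedding_generator_nonreal)
  then have "complex_of_real \<alpha> \<noteq> \<sigma> \<alpha>" "complex_of_real \<alpha> \<noteq> cnj (\<sigma> \<alpha>)" "\<sigma> \<alpha> \<noteq> cnj (\<sigma> \<alpha>)"
    by (metis Reals_of_real, metis Reals_of_real complex_cnj_cnj complex_cnj_complex_of_real,
        metis Reals_cnj_iff)
  then have "d - c = 0"
    using r w wc by (rule int_quad_eq_0)
  then show "d = c" by simp
qed

section \<open>Candidate states\<close>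

text \<open>The entries of a state lie in the subring of integer quadratic expressions in \<alpha>,
  and a move combines them with integer coefficients.\<close>

lemma candidate_next_state_int_quad:
  assumes root: "\<alpha> ^ 3 = int_quad e \<alpha>" and cand: "candidate_next_state \<alpha> \<sigma>r s'"
  obtains C :: "int^3^3" where "\<And>i. s' $ i = int_quad (C $ i) \<alpha>"
proof -
  let ?S = "range (\<lambda>c. int_quad c \<alpha>)"
  have S: "is_subring ?S"
    using root by (rule is_subring_int_quad)
  have "\<alpha> = int_quad (vector [0, 1, 0]) \<alpha>"
    by (simp add: int_quad_def)
  then have "{\<alpha>} \<subseteq> ?S" by blast
  then have L: "lattice_L \<alpha> \<subseteq> ?S"
    unfolding lattice_L_def using S by (rule hull_minimal)
  obtain s \<pi> u and M :: "int^3^3"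
    where s: "is_state \<alpha> s" and u: "u = (\<chi> i. s $ \<pi> i)" and s': "s' = map_matrix of_int M *v u"
    using cand unfolding candidate_next_state_def admissible_state_def by blast
  have uS: "u $ i \<in> ?S" for i
    using s L by (auto simp: u is_state_def)
  have mult: "a \<in> ?S \<Longrightarrow> b \<in> ?S \<Longrightarrow> a * b \<in> ?S" for a b
    using S unfolding is_subring_def by blast
  have "s' $ i \<in> ?S" for i
    unfolding s' matrix_vector_mult_def map_matrix_def
    by (simp add: sum_3) (intro is_subring_add[OF S] mult is_subring_of_int[OF S] uS)
  then have "\<forall>i. \<exists>c. s' $ i = int_quad c \<alpha>" by blast
  then obtain f where "\<And>i. s' $ i = int_quad (f i) \<alpha>" by metis
  then have "s' $ i = int_quad ((\<chi> i. f i) $ i) \<alpha>" for i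
    by simp
  then show thesis by (rule that)
qed

lemma det3_embeddings_nonzero:
  assumes "\<alpha> ^ 3 = int_quad e \<alpha>"
    and \<sigma>r: "field_embedding (field_K \<alpha>) \<sigma>r"
    and \<sigma>c: "complex_embedding (field_K \<alpha>) \<sigma>c"
    and "candidate_next_state \<alpha> \<sigma>r s'"
    and det: "coord_det \<alpha> s' \<noteq> 0"
  shows "det3 (cvec (xi_vec \<sigma>r s')) (nu_vec \<sigma>c s') (cnj_vec (nu_vec \<sigma>c s')) \<noteq> 0"
proof -
  obtain C :: "int^3^3" where C: "\<And>i. s' $ i = int_quad (C $ i) \<alpha>"
    using assms(1,4) by (rule candidate_next_state_int_quad) blast
  \<comment> \<open>Uniqueness of coordinates identifies the chosen \<open>C\<close> with the matrix
    in \<open>coord_det\<close>.\<close>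
  have "(\<chi> i. coords \<alpha> (s' $ i)) = C"
    by (simp add: vec_eq_iff C coords_int_quad[OF \<sigma>c])
  then have detC: "det C \<noteq> 0"
    using det by (simp add: coord_det_def)
  have \<sigma>c': "field_embedding (field_K \<alpha>) \<sigma>c"
    using \<sigma>c by (simp add: complex_embedding_def)
  let ?r = "complex_of_real (\<sigma>r \<alpha>)" and ?w = "\<sigma>c \<alpha>"
  have xi: "cvec (xi_vec \<sigma>r s') = (\<chi> i. int_quad (C $ i) ?r)"
    by (simp add: vec_eq_iff cvec_def xi_vec_def C
        field_embedding_int_quad[OF is_subfield_field_K \<sigma>r generator_in_field_K])
      (simp add: int_quad_def)
  have nu: "nu_vec \<sigma>c s' = (\<chi> i. int_quad (C $ i) ?w)"
    by (simp add: vec_eq_iff nu_vec_def C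
        field_embedding_int_quad[OF is_subfield_field_K \<sigma>c' generator_in_field_K])
  have nu': "cnj_vec (nu_vec \<sigma>c s') = (\<chi> i. int_quad (C $ i) (cnj ?w))"
    by (simp add: nu cnj_vec_def cnj_int_quad)
  have "?w \<notin> \<real>"
    using \<sigma>c by (rule complex_embedding_generator_nonreal)
  then have "?w \<noteq> ?r" "cnj ?w \<noteq> ?r" "cnj ?w \<noteq> ?w"
    by (metis Reals_of_real, metis Reals_of_real complex_cnj_cnj complex_cnj_complex_of_real,
        metis Reals_cnj_iff)
  then show ?thesis
    \<comment> \<open>\<open>nu'\<close> comes first: rewriting with \<open>nu\<close> would destroy
      its left-hand side.\<close>
    unfolding nu' unfolding xi nu det3_int_quad using detC by simp
qed

theorem lemma2p2:
  fixes p :: "int poly" and \<alpha> :: real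
    and \<sigma>r :: "real \<Rightarrow> real" and \<sigma>c :: "real \<Rightarrow> complex" and s' :: "real^3"
  assumes "lead_coeff p = 1" and "degree p = 3" and "irreducible p" and "has_signature p 1 1"
    and "poly (map_poly of_int p) \<alpha> = 0"
    and "field_embedding (field_K \<alpha>) \<sigma>r"
    and "complex_embedding (field_K \<alpha>) \<sigma>c"
    and "candidate_next_state \<alpha> \<sigma>r s'"
    and "coord_det \<alpha> s' \<noteq> 0"
    and "bilin_dot (n1 \<sigma>r \<sigma>c s') (n1 \<sigma>r \<sigma>c s') \<noteq> 0"
  shows "score \<sigma>r \<sigma>c s' =
           - ((cmod (det3 (cvec (xi_vec \<sigma>r s')) (nu_vec \<sigma>c s') (cnj_vec (nu_vec \<sigma>c s'))))\<^sup>2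
                * (norm (xi_vec \<sigma>r s'))\<^sup>2)
             / (cmod (bilin_dot (n1 \<sigma>r \<sigma>c s') (n1 \<sigma>r \<sigma>c s')))\<^sup>2
         \<and> score_ratio \<sigma>r \<sigma>c s' \<in> \<real>
         \<and> score \<sigma>r \<sigma>c s' < 0"
proof -
  let ?\<xi> = "xi_vec \<sigma>r s'"
  let ?d = "det3 (cvec ?\<xi>) (nu_vec \<sigma>c s') (cnj_vec (nu_vec \<sigma>c s'))"
    and ?n = "bilin_dot (n1 \<sigma>r \<sigma>c s') (n1 \<sigma>r \<sigma>c s')"
  have "\<alpha> ^ 3 = int_quad (- vector [coeff p 0, coeff p 1, coeff p 2]) \<alpha>"
    using monic_cubic_root[OF assms(1,2,5)] by (simp add: int_quad_def)
  then have d: "?d \<noteq> 0"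
    using assms(6-9) by (rule det3_embeddings_nonzero)
  \<comment> \<open>A zero first column would make the determinant vanish.\<close>
  then have "?\<xi> \<noteq> 0"
    by (auto simp: det3_expand cvec_def)
  with d assms(10) have "- ((cmod ?d)\<^sup>2 * (norm ?\<xi>)\<^sup>2) / (cmod ?n)\<^sup>2 < 0"
    by simp
  then show ?thesis
    unfolding score_def score_ratio_eq by (simp only: Re_complex_of_real Reals_of_real simp_thms)
qed

end
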